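(* (Extended Jensen's inequality for CCMP) Suppose $H_k=H$ and $f_k=f$ for all $k=1,\dots,K$, and $0\le\varepsilon<1$. Let $x^0\in X$, let $z^0$ be an optimal $z$ with respect to $x^0$, and define $E\eta(x^0)=\sum_{k=1}^K\pi_k(1-z^0_k)\eta^*_k(x^0)$, the optimal expected recourse cost from responsive scenarios. If $E\eta(x^0)<+\infty$, then $$E\eta(x^0)\ \ge\ \min\Big\{\Big(1-\sum_{k=1}^K\pi_kz_k\Big)f\bar y:\ \ H\bar y\ge\frac{\sum_{k=1}^K\pi_k(1-z_k)(h_k-G_kx^0)}{1-\sum_{k=1}^K\pi_kz_k},\ \ \sum_{k=1}^K\pi_kz_k\le\varepsilon,\ \ \bar y\ge 0,\ z\in\{0,1\}^K\Big\}.$$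
   Context: Data: scenarios $k=1,\dots,K$ with probabilities $\pi_k\ge 0$, $\sum_k\pi_k=1$; risk tolerance $\varepsilon$; real matrices and vectors $A,b$ and $G_k,H_k,h_k,f_k$ of compatible dimensions. $X=\{x\in\mathbb{R}^{n_1}_+\times\mathbb{Z}^{n_2}_+:\ Ax\ge b\}\ne\emptyset$. For $x\in X$ the recourse value of scenario $k$ is $\eta^*_k(x)=\min\{f_ky_k:\ H_ky_k\ge h_k-G_kx,\ y_k\in\mathbb{R}^m_+\}$, equal to $+\infty$ if infeasible and $-\infty$ if unbounded. Standing assumption: for every $k$ there exists some $x\in X$ with $-\infty<\eta^*_k(x)<+\infty$. A binary $z_k=1$ means scenario $k$ is non-responsive (ignored), $z_k=0$ that it is responsive. "$z^0$ is optimal with respect to $x^0$" means $z^0$ minimizes $\sum_k\pi_k(1-z_k)\eta^*_k(x^0)$ over $z\in\{0,1\}^K$ with $\sum_k\pi_kz_k\le\varepsilon$, where terms with $z_k=1$ count as $0$. The minimum on the right-hand side is understood as an infimum. *)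

theory Defs
  imports "HOL-Analysis.Analysis"
begin

text \<open>
  Order relations between vectors are componentwise. The set \<open>J\<close> holds the coordinates of \<open>x\<close>
  that are restricted to integers: \<open>\<real>\<close>-valued and integer-valued parts of dimensions \<open>n\<^sub>1\<close> and
  \<open>n\<^sub>2\<close> correspond to \<open>card (- J) = n\<^sub>1\<close> and \<open>card J = n\<^sub>2\<close>, where either may be zero.
\<close>

definition mixed_integer_set :: "real^'n^'p \<Rightarrow> real^'p \<Rightarrow> 'n set \<Rightarrow> (real^'n) set" where
  "mixed_integer_set A b J = {x. 0 \<le> x \<and> (\<forall>j\<in>J. x $ j \<in> \<int>) \<and> A *v x \<ge> b}"

text \<open>
  The infimum is taken in the extended reals: it is \<open>\<infinity>\<close> if the recourse problem is
  infeasible and \<open>-\<infinity>\<close> if it is unbounded.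
\<close>

definition recourse_value ::
  "real^'m \<Rightarrow> real^'m^'l \<Rightarrow> real^'n^'l \<Rightarrow> real^'l \<Rightarrow> real^'n \<Rightarrow> ereal" where
  "recourse_value f H G h x = (INF y\<in>{y. H *v y \<ge> h - G *v x \<and> 0 \<le> y}. ereal (f \<bullet> y))"

definition chance_selections :: "('k::finite \<Rightarrow> real) \<Rightarrow> real \<Rightarrow> ('k \<Rightarrow> real) set" where
  "chance_selections \<pi> \<epsilon> = {z. (\<forall>k. z k \<in> {0, 1}) \<and> (\<Sum>k\<in>UNIV. \<pi> k * z k) \<le> \<epsilon>}"

text \<open>
  Since \<open>0 * \<infinity> = 0\<close> in \<^typ>\<open>ereal\<close>, scenarios with \<open>z k = 1\<close> contribute \<open>0\<close>
  even if their recourse value is infinite; the same holds for scenarios of probability \<open>0\<close>.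
  The sum is meaningful only if \<open>\<infinity>\<close> and \<open>-\<infinity>\<close> do not both occur among its terms.
\<close>

definition responsive_cost :: "('k::finite \<Rightarrow> real) \<Rightarrow> ('k \<Rightarrow> ereal) \<Rightarrow> ('k \<Rightarrow> real) \<Rightarrow> ereal" where
  "responsive_cost \<pi> \<eta> z = (\<Sum>k\<in>UNIV. ereal (\<pi> k * (1 - z k)) * \<eta> k)"

definition optimal_selection ::
  "('k::finite \<Rightarrow> real) \<Rightarrow> real \<Rightarrow> ('k \<Rightarrow> ereal) \<Rightarrow> ('k \<Rightarrow> real) \<Rightarrow> bool" where
  "optimal_selection \<pi> \<epsilon> \<eta> z0 \<longleftrightarrow>
     z0 \<in> chance_selections \<pi> \<epsilon> \<and>
     (\<forall>z\<in>chance_selections \<pi> \<epsilon>. responsive_cost \<pi> \<eta> z0 \<le> responsive_cost \<pi> \<eta> z)"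

end

theory Submission
  imports Defs
begin

text \<open>
  Weighting feasible recourse decisions of the responsive scenarios by their conditional
  probabilities gives an aggregated decision \<open>y\<close> that is feasible for the averaged problem, since
  its constraints are linear and all scenarios share \<open>H0\<close>. Its cost equals the expected cost of
  the individual decisions because they also share \<open>f0\<close>. Letting these decisions approach the
  recourse values proves the inequality already for the fixed selection \<open>z0\<close>.
\<close>

text \<open>In \<open>ereal\<close>, \<open>\<infinity>\<close> plus anything is
  \<open>\<infinity>\<close>, so neither summand can be \<open>\<infinity>\<close>. Two finite
  summands share the slack equally; a summand \<open>-\<infinity>\<close> tolerates any real bound
  and so takes up whatever the other leaves.\<close>

lemma ereal_add_less_split:
  fixes a b :: ereal and c :: real
  assumes "a + b < ereal c"
  obtains c1 c2 :: real where "a < ereal c1" "b < ereal c2" "c1 + c2 = c"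
proof (cases a; cases b)
  fix r s assume ab: "a = ereal r" "b = ereal s"
  show thesis
    using assms by (intro that[of "r + (c - r - s) / 2" "s + (c - r - s) / 2"]) (auto simp: ab)
next
  fix r assume ab: "a = ereal r" "b = -\<infinity>"
  show thesis by (rule that[of "r + 1" "c - r - 1"]) (auto simp: ab)
next
  fix s assume ab: "a = -\<infinity>" "b = ereal s"
  show thesis by (rule that[of "c - s - 1" "s + 1"]) (auto simp: ab)
next
  assume ab: "a = -\<infinity>" "b = -\<infinity>"
  show thesis by (rule that[of c 0]) (auto simp: ab)
qed (use assms in auto)

text \<open>The bounds sum to at most \<open>c\<close>, not exactly \<open>c\<close> as for two
  summands, because the empty sum is 0 for every positive \<open>c\<close>.\<close>

lemma ereal_sum_less_split:
  fixes t :: "'k \<Rightarrow> ereal" and c :: real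
  assumes "finite S" "(\<Sum>k\<in>S. t k) < ereal c"
  shows "\<exists>r. (\<forall>k\<in>S. t k < ereal (r k)) \<and> (\<Sum>k\<in>S. r k) \<le> c"
  using assms
proof (induction S arbitrary: c rule: finite_induct)
  case empty
  then show ?case by simp
next
  case (insert k S)
  then have "t k + (\<Sum>k\<in>S. t k) < ereal c" by simp
  then obtain c1 c2 where c: "t k < ereal c1" "(\<Sum>k\<in>S. t k) < ereal c2" "c1 + c2 = c"
    by (rule ereal_add_less_split)
  from insert.IH[OF c(2)] obtain r
    where r: "\<forall>k\<in>S. t k < ereal (r k)" "(\<Sum>k\<in>S. r k) \<le> c2" by blast
  have "(\<Sum>i\<in>S. (r(k := c1)) i) = (\<Sum>i\<in>S. r i)"
    using insert.hyps by (intro sum.cong) auto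
  then show ?case
    using insert.hyps c r by (intro exI[of _ "r(k := c1)"]) auto
qed

lemma weighted_INF_less_witness:
  fixes \<phi> :: "'a \<Rightarrow> real" and w r :: real
  assumes "w > 0" "ereal w * (INF y\<in>F. ereal (\<phi> y)) < ereal r"
  obtains y where "y \<in> F" "w * \<phi> y < r"
proof -
  have "(INF y\<in>F. ereal (\<phi> y)) < ereal (r / w)"
    using assms
    by (cases "INF y\<in>F. ereal (\<phi> y)") (auto simp: field_simps)
  then obtain y where "y \<in> F" "\<phi> y < r / w"
    by (auto simp: INF_less_iff)
  then show thesis
    using assms(1) by (intro that[of y]) (auto simp: field_simps)
qed

text \<open>Selects near-optimal decisions for all indices at once. For weight 0 the set
  \<open>F k\<close> may be empty, so the harmless default \<open>0\<close> stands in for a member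
  of it.\<close>

lemma weighted_sum_INF_less_witness:
  fixes \<phi> :: "'a::zero \<Rightarrow> real" and w :: "'k \<Rightarrow> real" and c :: real
  assumes "finite S" "\<And>k. k \<in> S \<Longrightarrow> w k \<ge> 0"
    and "(\<Sum>k\<in>S. ereal (w k) * (INF y\<in>F k. ereal (\<phi> y))) < ereal c"
  shows "\<exists>y. (\<forall>k\<in>S. if w k = 0 then y k = 0 else y k \<in> F k) \<and> (\<Sum>k\<in>S. w k * \<phi> (y k)) \<le> c"
proof -
  obtain r where r: "\<forall>k\<in>S. ereal (w k) * (INF y\<in>F k. ereal (\<phi> y)) < ereal (r k)"
      "(\<Sum>k\<in>S. r k) \<le> c"
    using ereal_sum_less_split[OF assms(1,3)] by blast
  have "\<exists>y. (if w k = 0 then y = 0 else y \<in> F k) \<and> w k * \<phi> y \<le> r k" if "k \<in> S" for k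
  proof (cases "w k = 0")
    case True
    moreover have "ereal (w k) * (INF y\<in>F k. ereal (\<phi> y)) < ereal (r k)"
      using r(1) that by blast
    \<comment> \<open>The product is 0 even when the infimum is infinite, so the bound
      \<open>r k\<close> covers the zero cost of the default.\<close>
    ultimately have "0 < r k"
      by (simp add: zero_ereal_def[symmetric])
    with True show ?thesis by simp
  next
    case False
    then have "w k > 0" using assms(2)[OF that] by simp
    moreover have "ereal (w k) * (INF y\<in>F k. ereal (\<phi> y)) < ereal (r k)"
      using r(1) that by blast
    ultimately obtain y where "y \<in> F k" "w k * \<phi> y < r k"
      by (rule weighted_INF_less_witness)
    with False show ?thesis by auto
  qed
  then have "\<forall>k\<in>S. \<exists>y. (if w k = 0 then y = 0 else y \<in> F k) \<and> w k * \<phi> y \<le> r k"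
    by blast
  then obtain y where y: "\<forall>k\<in>S. (if w k = 0 then y k = 0 else y k \<in> F k) \<and> w k * \<phi> (y k) \<le> r k"
    unfolding bchoice_iff by blast
  then have "(\<Sum>k\<in>S. w k * \<phi> (y k)) \<le> c"
    by (intro order.trans[OF sum_mono r(2)]) auto
  with y show ?thesis by blast
qed

theorem theorem4:
  fixes \<pi> :: "'k::finite \<Rightarrow> real" and \<epsilon> :: real
    and A :: "real^'n^'p" and b :: "real^'p" and J :: "'n set"
    and G :: "'k \<Rightarrow> real^'n^'l" and H :: "'k \<Rightarrow> real^'m^'l"
    and h :: "'k \<Rightarrow> real^'l" and f :: "'k \<Rightarrow> real^'m"
    and H0 :: "real^'m^'l" and f0 :: "real^'m"
    and x0 :: "real^'n" and z0 :: "'k \<Rightarrow> real"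
  defines "X \<equiv> mixed_integer_set A b J"
    and "\<eta> \<equiv> (\<lambda>x k. recourse_value (f k) (H k) (G k) (h k) x)"
  assumes prob_nonneg: "\<And>k. \<pi> k \<ge> 0" and prob_sum: "(\<Sum>k\<in>UNIV. \<pi> k) = 1"
    and X_nonempty: "X \<noteq> {}"
    and finite_recourse: "\<And>k. \<exists>x\<in>X. -\<infinity> < \<eta> x k \<and> \<eta> x k < \<infinity>"
    and common_H: "\<And>k. H k = H0" and common_f: "\<And>k. f k = f0"
    and eps: "0 \<le> \<epsilon>" "\<epsilon> < 1"
    and x0: "x0 \<in> X"
    and z0: "optimal_selection \<pi> \<epsilon> (\<eta> x0) z0"
    and cost_finite: "responsive_cost \<pi> (\<eta> x0) z0 < \<infinity>"
  shows "responsive_cost \<pi> (\<eta> x0) z0 \<ge>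
    (INF (y, z) \<in> {(y, z).
        H0 *v y \<ge> (\<Sum>k\<in>UNIV. (\<pi> k * (1 - z k)) *\<^sub>R (h k - G k *v x0)) /\<^sub>R
                    (1 - (\<Sum>k\<in>UNIV. \<pi> k * z k)) \<and>
        (\<Sum>k\<in>UNIV. \<pi> k * z k) \<le> \<epsilon> \<and> 0 \<le> y \<and> (\<forall>k. z k \<in> {0, 1})}.
      ereal ((1 - (\<Sum>k\<in>UNIV. \<pi> k * z k)) * (f0 \<bullet> y)))"
proof -
  define w where "w = (\<lambda>k. \<pi> k * (1 - z0 k))"
  define W where "W = 1 - (\<Sum>k\<in>UNIV. \<pi> k * z0 k)"
  define F where "F = (\<lambda>k. {y. H0 *v y \<ge> h k - G k *v x0 \<and> 0 \<le> y})"
  define R where "R = {(y, z).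
        H0 *v y \<ge> (\<Sum>k\<in>UNIV. (\<pi> k * (1 - z k)) *\<^sub>R (h k - G k *v x0)) /\<^sub>R
                    (1 - (\<Sum>k\<in>UNIV. \<pi> k * z k)) \<and>
        (\<Sum>k\<in>UNIV. \<pi> k * z k) \<le> \<epsilon> \<and> 0 \<le> y \<and> (\<forall>k. z k \<in> {0, 1})}"
  define obj where
    "obj = (\<lambda>(y, z). ereal ((1 - (\<Sum>k\<in>UNIV. \<pi> k * z k)) * (f0 \<bullet> y)))"
  have z0_binary: "z0 k \<in> {0, 1}" and z0_risk: "(\<Sum>k\<in>UNIV. \<pi> k * z0 k) \<le> \<epsilon>" for k
    using z0 by (auto simp: optimal_selection_def chance_selections_def)
  have w_nonneg: "w k \<ge> 0" for k
    using z0_binary[of k] prob_nonneg[of k] by (auto simp: w_def)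
  have W_pos: "W > 0"
    using z0_risk eps by (simp add: W_def)
  have cost_eq: "responsive_cost \<pi> (\<eta> x0) z0 =
      (\<Sum>k\<in>UNIV. ereal (w k) * (INF y\<in>F k. ereal (f0 \<bullet> y)))"
    by (simp add: responsive_cost_def \<eta>_def recourse_value_def w_def F_def common_H common_f)
  \<comment> \<open>A real \<open>c\<close> strictly above the cost leaves room for decisions that
    only approach the recourse values, and covers the cost \<open>-\<infinity>\<close> too.\<close>
  have "(INF p\<in>R. obj p) \<le> ereal c" if c: "responsive_cost \<pi> (\<eta> x0) z0 < ereal c" for c
  proof -
    obtain y where y: "\<And>k. if w k = 0 then y k = 0 else y k \<in> F k"
      and y_cost: "(\<Sum>k\<in>UNIV. w k * (f0 \<bullet> y k)) \<le> c"
      using weighted_sum_INF_less_witness[where S = UNIV and w = w and F = F and \<phi> = "\<lambda>y. f0 \<bullet> y",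
          OF finite w_nonneg c[unfolded cost_eq]]
      by blast
    \<comment> \<open>By \<open>prob_sum\<close> the weights \<open>w k\<close> add up to
      \<open>W\<close>, so this is the mean of the decisions conditional on a responsive
      scenario.\<close>
    define ybar where "ybar = (\<Sum>k\<in>UNIV. w k *\<^sub>R y k) /\<^sub>R W"
    \<comment> \<open>If \<open>w k = 0\<close>, then \<open>y k = 0\<close> may violate the
      constraints of scenario \<open>k\<close>, but both scaled sides vanish.\<close>
    have "w k *\<^sub>R (h k - G k *v x0) \<le> w k *\<^sub>R (H0 *v y k)" and y_nonneg: "0 \<le> y k" for k
      using y[of k] w_nonneg[of k]
      by (auto simp: F_def split: if_splits intro!: scaleR_left_mono)
    then have "(\<Sum>k\<in>UNIV. w k *\<^sub>R (h k - G k *v x0)) \<le> (\<Sum>k\<in>UNIV. w k *\<^sub>R (H0 *v y k))"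
      by (intro sum_mono)
    also have "\<dots> = H0 *v (\<Sum>k\<in>UNIV. w k *\<^sub>R y k)"
      by (simp add: linear_sum[OF matrix_vector_mul_linear] matrix_vector_mult_scaleR)
    finally have "(\<Sum>k\<in>UNIV. w k *\<^sub>R (h k - G k *v x0)) /\<^sub>R W \<le> H0 *v ybar"
      using W_pos by (auto simp: ybar_def matrix_vector_mult_scaleR intro!: scaleR_left_mono)
    moreover have "0 \<le> ybar"
      unfolding ybar_def
      using W_pos w_nonneg y_nonneg by (intro scaleR_nonneg_nonneg sum_nonneg) auto
    ultimately have "(ybar, z0) \<in> R"
      using z0_binary z0_risk by (simp add: R_def w_def W_def)
    then have "(INF p\<in>R. obj p) \<le> obj (ybar, z0)"
      by (rule INF_lower)
    \<comment> \<open>The factor \<open>W\<close> of the objective cancels the normalization in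
      \<open>ybar\<close>.\<close>
    also have "W * (f0 \<bullet> ybar) = (\<Sum>k\<in>UNIV. w k * (f0 \<bullet> y k))"
      using W_pos by (simp add: ybar_def inner_sum_right)
    then have "obj (ybar, z0) \<le> ereal c"
      using y_cost by (simp add: obj_def W_def)
    finally show ?thesis .
  qed
  then have "(INF p\<in>R. obj p) \<le> responsive_cost \<pi> (\<eta> x0) z0"
    \<comment> \<open>Were the infimum larger than the cost, a real \<open>c\<close> strictly
      between them would contradict the bound just shown.\<close>
    using ereal_dense2[of "responsive_cost \<pi> (\<eta> x0) z0" "INF p\<in>R. obj p"]
    by (auto simp: not_le[symmetric])
  then show ?thesis
    unfolding R_def obj_def .
qed

end
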